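(* For every integer $r\geq 1$, the $r$-dimensional hypercube $Q_r$ satisfies $$\mathrm{gpn}(Q_r)=2^{r-1}\cdot r!\sum_{j=0}^{r-1}\frac{1}{j!}+2^{r},$$ and consequently $\mathrm{gpn}(Q_r)\sim 2^{r-1}\cdot r!\cdot e+2^{r}$ as $r\to\infty$ (i.e. the ratio of the two sides tends to $1$).
   Context: For distinct vertices $u,v$ of a connected simple graph $G$, $\mathrm{gpn}_G(u,v)$ denotes the number of shortest $u$–$v$ paths in $G$, and for a graph $G$ on $n$ vertices $\mathrm{gpn}(G)=\sum_{\{u,v\}\subseteq V(G),\,u\neq v}\mathrm{gpn}_G(u,v)+n$ (sum over unordered pairs of distinct vertices). $Q_r$ is the graph with vertex set $\{0,1\}^r$ in which two vertices are adjacent if and only if they differ in exactly one coordinate; it has $2^r$ vertices. Here $e$ is the base of the natural logarithm. *)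

theory Defs
  imports
    Complex_Main
    "HOL-Library.Landau_Symbols"
    "Graph_Theory.Graph_Theory"
begin

text \<open>Undirected graphs are represented as symmetric digraphs; a simple graph is one
  satisfying the locale predicate \<open>pair_graph\<close> (finite, symmetric, loop-free, no parallel arcs).\<close>

definition shortest_vpaths :: "('a, 'b) pre_digraph \<Rightarrow> 'a \<Rightarrow> 'a \<Rightarrow> 'a vwalk set" where
  "shortest_vpaths G u v =
     {p. vpath p G \<and> hd p = u \<and> last p = v \<and>
         (\<forall>q. vpath q G \<and> hd q = u \<and> last q = v \<longrightarrow> vwalk_length p \<le> vwalk_length q)}"

definition gpn_pair :: "('a, 'b) pre_digraph \<Rightarrow> 'a \<Rightarrow> 'a \<Rightarrow> nat" where
  "gpn_pair G u v = card (shortest_vpaths G u v)"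

text \<open>The value of \<open>gpn_pair\<close> at an unordered pair. It is well defined on a symmetric digraph
  by \<open>gpn_unordered_pair\<close> below.\<close>

definition gpn_unordered :: "('a, 'b) pre_digraph \<Rightarrow> 'a set \<Rightarrow> nat" where
  "gpn_unordered G e = (THE k. \<forall>u v. e = {u, v} \<longrightarrow> k = gpn_pair G u v)"

definition gpn :: "('a, 'b) pre_digraph \<Rightarrow> nat" where
  "gpn G = (\<Sum>e | e \<subseteq> verts G \<and> card e = 2. gpn_unordered G e) + card (verts G)"

definition hypercube :: "nat \<Rightarrow> bool list pair_pre_digraph" where
  "hypercube r =
     \<lparr>pverts = {x. length x = r},
      parcs = {(x, y). length x = r \<and> length y = r \<and> card {i. i < r \<and> x ! i \<noteq> y ! i} = 1}\<rparr>"

lemma vwalk_arcs_append_last: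
  "p \<noteq> [] \<Longrightarrow> vwalk_arcs (p @ [x]) = vwalk_arcs p @ [(last p, x)]"
  by (induction p rule: vwalk_arcs.induct) auto

lemma set_vwalk_arcs_rev: "set (vwalk_arcs (rev p)) = (set (vwalk_arcs p))\<inverse>"
  by (induction p rule: vwalk_arcs.induct)
    (auto simp: vwalk_arcs_append_last last_rev simp flip: append_assoc)

lemma vpath_rev:
  assumes "symmetric G"
  shows "vpath (rev p) G \<longleftrightarrow> vpath p G"
proof -
  have "(arcs_ends G)\<inverse> = arcs_ends G"
    using assms by (simp add: symmetric_def sym_conv_converse_eq)
  then show ?thesis
    unfolding vpath_def vwalk_def set_vwalk_arcs_rev by auto
qed

lemma gpn_pair_commute:
  assumes "symmetric G"
  shows "gpn_pair G u v = gpn_pair G v u"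
proof -
  have sub: "rev ` shortest_vpaths G a b \<subseteq> shortest_vpaths G b a" for a b
  proof
    fix q assume "q \<in> rev ` shortest_vpaths G a b"
    then obtain p where p: "q = rev p" "p \<in> shortest_vpaths G a b" by blast
    have ne: "vpath s G \<Longrightarrow> s \<noteq> []" for s by (auto simp: vpath_def vwalk_def)
    have "vwalk_length q \<le> vwalk_length s" if s: "vpath s G" "hd s = b" "last s = a" for s
    proof -
      have "vpath (rev s) G" "hd (rev s) = a" "last (rev s) = b"
        using s ne vpath_rev[OF assms] by (auto simp: hd_rev last_rev)
      then have "vwalk_length p \<le> vwalk_length (rev s)"
        using p(2) unfolding shortest_vpaths_def by blast
      then show ?thesis by (simp add: p(1))
    qed
    moreover have "vpath q G" "hd q = b" "last q = a"
      using p ne vpath_rev[OF assms] by (auto simp: shortest_vpaths_def hd_rev last_rev)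
    ultimately show "q \<in> shortest_vpaths G b a" by (simp add: shortest_vpaths_def)
  qed
  have "rev ` shortest_vpaths G u v = shortest_vpaths G v u"
  proof
    show "shortest_vpaths G v u \<subseteq> rev ` shortest_vpaths G u v"
    proof
      fix p assume "p \<in> shortest_vpaths G v u"
      then have "rev p \<in> shortest_vpaths G u v" using sub by blast
      then show "p \<in> rev ` shortest_vpaths G u v" by (metis image_eqI rev_rev_ident)
    qed
  qed (rule sub)
  then show ?thesis
    unfolding gpn_pair_def by (metis card_image inj_on_rev)
qed

lemma gpn_unordered_pair:
  assumes "symmetric G"
  shows "gpn_unordered G {u, v} = gpn_pair G u v"
  unfolding gpn_unordered_def
  by (rule the_equality) (auto simp: doubleton_eq_iff gpn_pair_commute[OF assms])

lemma parcs_hypercube_commute: "(x, y) \<in> parcs (hypercube r) \<longleftrightarrow> (y, x) \<in> parcs (hypercube r)"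
proof -
  have eq: "{i. i < r \<and> x ! i \<noteq> y ! i} = {i. i < r \<and> y ! i \<noteq> x ! i}"
    by (rule Collect_cong) metis
  show ?thesis
    unfolding hypercube_def pair_pre_digraph.select_convs mem_Collect_eq prod.case eq
    by (rule iffI; elim conjE; intro conjI; assumption)
qed

lemma pair_graph_hypercube: "pair_graph (hypercube r)"
proof
  have "finite {x :: bool list. length x = r}"
    using finite_lists_length_eq[of "UNIV :: bool set" r] by simp
  moreover have "parcs (hypercube r) \<subseteq> {x. length x = r} \<times> {x. length x = r}"
    by (auto simp: hypercube_def)
  ultimately show "finite (pverts (hypercube r))" "finite (parcs (hypercube r))"
    by (auto simp: hypercube_def intro: finite_subset)
  have "sym (parcs (hypercube r))"
    by (rule symI) (rule parcs_hypercube_commute[THEN iffD1])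
  then show "symmetric (hypercube r)"
    by (simp add: symmetric_def arcs_ends_def arc_to_ends_def)
next
  fix e assume e: "e \<in> parcs (hypercube r)"
  obtain x y where xy: "e = (x, y)" by (cases e)
  have mem: "length x = r \<and> length y = r \<and> card {i. i < r \<and> x ! i \<noteq> y ! i} = 1"
    using e unfolding xy hypercube_def pair_pre_digraph.select_convs mem_Collect_eq prod.case .
  show "fst e \<in> pverts (hypercube r)" "snd e \<in> pverts (hypercube r)"
    unfolding xy hypercube_def pair_pre_digraph.select_convs mem_Collect_eq fst_conv snd_conv
    using mem by blast+
  have "x \<noteq> y"
  proof
    assume "x = y"
    then have "{i. i < r \<and> x ! i \<noteq> y ! i} = {}" by blast
    then show False using mem by (metis card.empty zero_neq_one)
  qed
  then show "fst e \<noteq> snd e" by (simp add: xy)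
qed

end

theory Submission
  imports Defs
begin

text \<open>A walk from \<open>u\<close> to \<open>v\<close> flips every coordinate in which they differ, so it has length at
  least their Hamming distance \<open>k\<close>; the walks of length exactly \<open>k\<close> flip each of these coordinates
  once, in an arbitrary order, so there are \<open>k!\<close> of them. Summing over ordered pairs, each \<open>u\<close>
  contributes the sum of \<open>|S|!\<close> over nonempty sets \<open>S\<close> of coordinates, that is, the sum of
  \<open>(r choose k) k! = r! / (r - k)!\<close> over \<open>1 \<le> k \<le> r\<close>. For the asymptotics, the partial sums of
  \<open>1 / j!\<close> tend to \<open>e\<close>.\<close>

section \<open>Coordinate flips and arcs of the cube\<close>

definition diff_set :: "nat \<Rightarrow> bool list \<Rightarrow> bool list \<Rightarrow> nat set" where
  "diff_set r x y = {i. i < r \<and> x ! i \<noteq> y ! i}"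

definition flip :: "nat \<Rightarrow> bool list \<Rightarrow> bool list" where
  "flip i x = x[i := \<not> x ! i]"

text \<open>Walks rather than paths, so that removing the first vertex leaves an object of the same
  kind with no distinctness condition to carry along.\<close>

definition hwalks :: "nat \<Rightarrow> nat \<Rightarrow> bool list \<Rightarrow> bool list \<Rightarrow> bool list list set" where
  "hwalks r n u v =
     {p. vwalk p (with_proj (hypercube r)) \<and> hd p = u \<and> last p = v \<and> vwalk_length p = n}"

lemma finite_diff_set [simp]: "finite (diff_set r x y)"
  by (simp add: diff_set_def)

lemma length_flip [simp]: "length (flip i x) = length x"
  by (simp add: flip_def)

lemma diff_set_flip:
  assumes "length u = r" "i < r"
  shows "diff_set r (flip i u) v =
    (if i \<in> diff_set r u v then diff_set r u v - {i} else insert i (diff_set r u v))"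
  using assms by (auto simp: diff_set_def flip_def nth_list_update)

lemma diff_set_empty_iff:
  "length u = r \<Longrightarrow> length v = r \<Longrightarrow> diff_set r u v = {} \<longleftrightarrow> u = v"
  by (auto simp: diff_set_def list_eq_iff_nth_eq)

lemma flip_inject:
  assumes "flip i u = flip j u" "i < length u" "j < length u"
  shows "i = j"
proof (rule ccontr)
  assume "i \<noteq> j"
  then have "flip i u ! i \<noteq> flip j u ! i"
    using assms(2,3) by (simp add: flip_def)
  then show False using assms(1) by simp
qed

lemma diff_set_flip_self: "length x = r \<Longrightarrow> i < r \<Longrightarrow> diff_set r x (flip i x) = {i}"
  by (auto simp: diff_set_def flip_def nth_list_update)

text \<open>Indexes the neighbours of a vertex by the flipped coordinate, so that counting first
  steps becomes counting coordinates.\<close>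

lemma hypercube_arc_iff:
  "(x, y) \<in> parcs (hypercube r) \<longleftrightarrow> length x = r \<and> (\<exists>i<r. y = flip i x)"
proof
  assume "(x, y) \<in> parcs (hypercube r)"
  then have l: "length x = r" "length y = r" "card (diff_set r x y) = 1"
    by (simp_all add: hypercube_def diff_set_def)
  then obtain i where i: "diff_set r x y = {i}" by (auto simp: card_1_singleton_iff)
  then have "i < r" by (auto simp: diff_set_def)
  moreover have "y = flip i x"
  proof (rule nth_equalityI)
    fix k assume "k < length y"
    then have "x ! k \<noteq> y ! k \<longleftrightarrow> k = i" using i l by (auto simp: diff_set_def)
    then show "y ! k = flip i x ! k" using l \<open>i < r\<close> by (auto simp: flip_def nth_list_update)
  qed (use l in simp)
  ultimately show "length x = r \<and> (\<exists>i<r. y = flip i x)" using l by blast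
next
  assume "length x = r \<and> (\<exists>i<r. y = flip i x)"
  then obtain i where i: "i < r" "y = flip i x" "length x = r" by blast
  then have "card (diff_set r x y) = 1" by (simp add: diff_set_flip_self)
  then show "(x, y) \<in> parcs (hypercube r)"
    using i by (simp add: hypercube_def diff_set_def)
qed

lemma verts_hypercube [simp]: "pverts (hypercube r) = {x. length x = r}"
  by (simp add: hypercube_def)

section \<open>Walks as short as the Hamming distance\<close>

lemma vwalk_hypercube_Cons:
  "vwalk (u # p) (with_proj (hypercube r)) \<longleftrightarrow> length u = r \<and>
     (p = [] \<or> (\<exists>i<r. hd p = flip i u) \<and> vwalk p (with_proj (hypercube r)))"
  by (cases p) (auto simp: vwalk_def hypercube_arc_iff)

text \<open>One arc lowers the Hamming distance to the end of the walk by at most one, and that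
  distance is zero at the end.\<close>

lemma card_diff_set_le_vwalk_length:
  assumes "vwalk p (with_proj (hypercube r))"
  shows "card (diff_set r (hd p) (last p)) \<le> vwalk_length p"
  using assms
proof (induction p rule: list.induct)
  case (Cons u p)
  show ?case
  proof (cases "p = []")
    case True
    then show ?thesis by (simp add: diff_set_def)
  next
    case False
    with Cons.prems obtain i where i: "i < r" "hd p = flip i u"
      and p: "length u = r" "vwalk p (with_proj (hypercube r))"
      by (auto simp: vwalk_hypercube_Cons)
    have "diff_set r u (last p) \<subseteq> insert i (diff_set r (flip i u) (last p))"
      using i p by (auto simp: diff_set_flip)
    then have "card (diff_set r u (last p)) \<le> card (insert i (diff_set r (flip i u) (last p)))"
      by (intro card_mono) auto
    also have "\<dots> \<le> Suc (card (diff_set r (flip i u) (last p)))"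
      by (rule card_insert_le_m1) auto
    finally show ?thesis
      using Cons.IH[OF p(2)] i False by (cases p) auto
  qed
qed (simp add: vwalk_def)

text \<open>Such a walk has no slack: its first step must flip a coordinate in which
  \<open>u\<close> and \<open>v\<close> differ, and any such coordinate will do.\<close>

lemma hwalks_Suc:
  assumes "card (diff_set r u v) = Suc n" "length u = r"
  shows "hwalks r (Suc n) u v = (\<Union>i\<in>diff_set r u v. Cons u ` hwalks r n (flip i u) v)"
proof (intro equalityI subsetI)
  fix p assume "p \<in> hwalks r (Suc n) u v"
  then have p: "vwalk p (with_proj (hypercube r))" "hd p = u" "last p = v" "vwalk_length p = Suc n"
    by (auto simp: hwalks_def)
  then obtain q where q: "p = u # q" "q \<noteq> []" "vwalk_length q = n" "last q = v"
    by (cases p; cases "tl p") auto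
  with p(1) obtain i where i: "i < r" "hd q = flip i u" "vwalk q (with_proj (hypercube r))"
    by (auto simp: vwalk_hypercube_Cons)
  \<comment> \<open>Only \<open>n\<close> steps remain. Flipping a coordinate outside
    \<open>diff_set r u v\<close> would raise the distance to \<open>n + 2\<close>.\<close>
  have "card (diff_set r (flip i u) v) \<le> n"
    using card_diff_set_le_vwalk_length[OF i(3)] i q by simp
  then have "i \<in> diff_set r u v"
    using assms i by (auto simp: diff_set_flip split: if_splits)
  then show "p \<in> (\<Union>i\<in>diff_set r u v. Cons u ` hwalks r n (flip i u) v)"
    using i q by (auto simp: hwalks_def)
next
  fix p assume "p \<in> (\<Union>i\<in>diff_set r u v. Cons u ` hwalks r n (flip i u) v)"
  then obtain i q where i: "i \<in> diff_set r u v" "p = u # q" "q \<in> hwalks r n (flip i u) v" by auto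
  then have "q \<noteq> []" "i < r" by (auto simp: hwalks_def diff_set_def)
  then show "p \<in> hwalks r (Suc n) u v"
    using i assms(2) by (cases q) (auto simp: hwalks_def vwalk_hypercube_Cons)
qed

lemma hwalks_0:
  assumes "length u = r"
  shows "hwalks r 0 u u = {[u]}"
proof -
  have "p = [u]" if "p \<in> hwalks r 0 u u" for p
    using that by (cases p; cases "tl p") (auto simp: hwalks_def)
  then show ?thesis using assms by (auto simp: hwalks_def vwalk_hypercube_Cons)
qed

text \<open>There are \<open>Suc n\<close> choices for the first flipped coordinate, and each leaves
  distance \<open>n\<close>, so the count obeys the recursion of the factorial.\<close>

lemma card_hwalks:
  assumes "card (diff_set r u v) = n" "length u = r" "length v = r"
  shows "finite (hwalks r n u v) \<and> card (hwalks r n u v) = fact n"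
  using assms
proof (induction n arbitrary: u)
  case 0
  then have "u = v" by (simp add: diff_set_empty_iff)
  then show ?case using 0 by (simp add: hwalks_0)
next
  case (Suc n)
  let ?D = "diff_set r u v"
  have lt: "i < r" if "i \<in> ?D" for i using that by (simp add: diff_set_def)
  have IH: "finite (hwalks r n (flip i u) v) \<and> card (hwalks r n (flip i u) v) = fact n"
    if "i \<in> ?D" for i
    using that lt[OF that] Suc.prems by (intro Suc.IH) (auto simp: diff_set_flip)
  \<comment> \<open>The second vertex of the walk is \<open>flip i u\<close>, which determines
    \<open>i\<close>.\<close>
  have disj: "Cons u ` hwalks r n (flip i u) v \<inter> Cons u ` hwalks r n (flip j u) v = {}"
    if "i \<in> ?D" "j \<in> ?D" "i \<noteq> j" for i j
    using that lt flip_inject[of i u j] Suc.prems by (auto simp: hwalks_def)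
  have "card (hwalks r (Suc n) u v) = (\<Sum>i\<in>?D. card (Cons u ` hwalks r n (flip i u) v))"
    unfolding hwalks_Suc[OF Suc.prems(1,2)] using IH disj by (intro card_UN_disjoint) auto
  also have "\<dots> = (\<Sum>i\<in>?D. fact n)"
    using IH by (intro sum.cong refl) (simp add: card_image)
  also have "\<dots> = fact (Suc n)" using Suc.prems by simp
  finally show ?case using IH by (simp add: hwalks_Suc[OF Suc.prems(1,2)])
qed

text \<open>Bridges walks and paths: \<open>shortest_vpaths\<close> is made of
  \<open>vpath\<close>s, whose vertices must be distinct.\<close>

lemma distinct_hwalks:
  assumes "p \<in> hwalks r n u v" "card (diff_set r u v) = n" "length u = r"
  shows "distinct p"
  using assms
proof (induction n arbitrary: u p)
  case 0
  then show ?case by (cases p; cases "tl p") (auto simp: hwalks_def)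
next
  case (Suc n)
  from Suc.prems obtain i q where i: "i \<in> diff_set r u v" "p = u # q"
      "q \<in> hwalks r n (flip i u) v"
    unfolding hwalks_Suc[OF Suc.prems(2,3)] by auto
  then have "i < r" by (simp add: diff_set_def)
  then have "card (diff_set r (flip i u) v) = n"
    using Suc.prems i by (simp add: diff_set_flip)
  then have dq: "distinct q" using Suc.IH[OF i(3)] Suc.prems by simp
  \<comment> \<open>Otherwise a proper suffix of the walk would already lead from \<open>u\<close> to \<open>v\<close>.\<close>
  have "u \<notin> set q"
  proof
    assume "u \<in> set q"
    then obtain a b where ab: "q = a @ u # b" by (auto simp: in_set_conv_decomp)
    have q: "vwalk q (with_proj (hypercube r))" "last q = v" "vwalk_length q = n"
      using i by (auto simp: hwalks_def)
    have "vwalk (u # b) (with_proj (hypercube r))"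
      using vwalkI_append_r[of "u # b" a] q(1) unfolding ab by simp
    from card_diff_set_le_vwalk_length[OF this] have "Suc n \<le> length b"
      using q(2) Suc.prems(2) unfolding ab by simp
    then show False using q(3) unfolding ab by simp
  qed
  then show ?case using dq i by simp
qed

lemma gpn_pair_hypercube:
  assumes "length u = r" "length v = r"
  shows "gpn_pair (with_proj (hypercube r)) u v = fact (card (diff_set r u v))"
proof -
  let ?n = "card (diff_set r u v)"
  note W = card_hwalks[OF refl assms]
  have vp: "vpath p (with_proj (hypercube r))" if "p \<in> hwalks r ?n u v" for p
    using that distinct_hwalks[OF that refl assms(1)] by (simp add: vpath_def hwalks_def)
  \<comment> \<open>The count \<open>fact ?n\<close> is positive, so the lower bound
    \<open>?n\<close> is attained and a shortest path has exactly this length.\<close>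
  have "hwalks r ?n u v \<noteq> {}" using W by force
  then obtain w where w: "w \<in> hwalks r ?n u v" by blast
  have lower: "?n \<le> vwalk_length q"
    if "vpath q (with_proj (hypercube r))" "hd q = u" "last q = v" for q
    using that card_diff_set_le_vwalk_length[of q r] unfolding vpath_def by metis
  have "shortest_vpaths (with_proj (hypercube r)) u v = hwalks r ?n u v"
  proof (intro equalityI subsetI)
    fix p assume "p \<in> shortest_vpaths (with_proj (hypercube r)) u v"
    then have p: "vpath p (with_proj (hypercube r))" "hd p = u" "last p = v"
      and short: "\<And>q. vpath q (with_proj (hypercube r)) \<Longrightarrow> hd q = u \<Longrightarrow> last q = v
        \<Longrightarrow> vwalk_length p \<le> vwalk_length q"
      unfolding shortest_vpaths_def by simp_all
    have "vwalk_length p \<le> ?n"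
      using short[OF vp[OF w]] w by (simp add: hwalks_def)
    then have "vwalk_length p = ?n" using lower[OF p] by (rule antisym)
    then show "p \<in> hwalks r ?n u v" using p by (simp add: hwalks_def vpath_def)
  next
    fix p assume p: "p \<in> hwalks r ?n u v"
    then have "hd p = u" "last p = v" "vwalk_length p = ?n"
      by (simp_all add: hwalks_def)
    then show "p \<in> shortest_vpaths (with_proj (hypercube r)) u v"
      using vp[OF p] lower unfolding shortest_vpaths_def by simp
  qed
  then show ?thesis using W by (simp add: gpn_pair_def)
qed

section \<open>From unordered pairs to sets of coordinates\<close>

text \<open>Double counting: the map from \<open>(u, v)\<close> to \<open>{u, v}\<close> has fibres
  of size two off the diagonal.\<close>

lemma sum_doubletons:
  fixes f :: "'a set \<Rightarrow> 'b::semiring_1"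
  assumes "finite V"
  shows "(\<Sum>(u, v) | u \<in> V \<and> v \<in> V \<and> u \<noteq> v. f {u, v}) = 2 * (\<Sum>e | e \<subseteq> V \<and> card e = 2. f e)"
proof -
  let ?T = "{(u, v). u \<in> V \<and> v \<in> V \<and> u \<noteq> v}" and ?S = "{e. e \<subseteq> V \<and> card e = 2}"
  let ?h = "\<lambda>(u, v). {u, v}"
  have fT: "finite ?T" by (rule finite_subset[of _ "V \<times> V"]) (use assms in auto)
  have "(\<Sum>x\<in>?T. f (?h x)) = (\<Sum>e\<in>?S. \<Sum>x | x \<in> ?T \<and> ?h x = e. f (?h x))"
    using assms fT by (intro sum.group[symmetric]) auto
  also have "\<dots> = (\<Sum>e\<in>?S. 2 * f e)"
  proof (rule sum.cong[OF refl])
    fix e assume "e \<in> ?S"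
    then obtain u v where e: "e = {u, v}" "u \<noteq> v" "u \<in> V" "v \<in> V"
      by (auto simp: card_2_iff)
    then have "{x. x \<in> ?T \<and> ?h x = e} = {(u, v), (v, u)}" by (auto simp: doubleton_eq_iff)
    then show "(\<Sum>x | x \<in> ?T \<and> ?h x = e. f (?h x)) = 2 * f e"
      using e by (simp add: insert_commute mult_2)
  qed
  finally show ?thesis by (simp add: sum_distrib_left case_prod_unfold)
qed

lemma sum_fact_card_Pow:
  assumes "finite A"
  shows "(\<Sum>S\<in>Pow A - {{}}. fact (card S)) =
    fact (card A) * (\<Sum>j<card A. 1 / fact j :: real)"
proof -
  let ?r = "card A"
  have "(\<Sum>S\<in>Pow A - {{}}. fact (card S) :: real) =
      (\<Sum>k\<in>{1..?r}. \<Sum>S | S \<in> Pow A - {{}} \<and> card S = k. fact (card S))"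
    using assms
    by (intro sum.group[symmetric])
      (auto intro: card_mono simp: Suc_le_eq card_gt_0_iff finite_subset)
  also have "\<dots> = (\<Sum>k\<in>{1..?r}. fact ?r / fact (?r - k))"
  proof (rule sum.cong[OF refl])
    fix k assume k: "k \<in> {1..?r}"
    then have "{S. S \<in> Pow A - {{}} \<and> card S = k} = {S. S \<subseteq> A \<and> card S = k}" by auto
    then have "(\<Sum>S | S \<in> Pow A - {{}} \<and> card S = k. fact (card S)) = real (?r choose k) * fact k"
      using n_subsets[OF assms, of k] by simp
    also have "\<dots> = fact ?r / fact (?r - k)"
      using k by (simp add: binomial_fact)
    finally show "(\<Sum>S | S \<in> Pow A - {{}} \<and> card S = k. fact (card S)) =
      (fact ?r / fact (?r - k) :: real)" .
  qed
  \<comment> \<open>Substitute \<open>j = ?r - k\<close>. Leaving out the empty set,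
    \<open>k = 0\<close>, is what removes the term \<open>j = ?r\<close>.\<close>
  also have "\<dots> = (\<Sum>j<?r. fact ?r / fact j)"
    by (rule sum.reindex_bij_witness[of _ "\<lambda>j. ?r - j" "\<lambda>k. ?r - k"]) auto
  finally show ?thesis by (simp add: sum_distrib_left)
qed

text \<open>For fixed \<open>u\<close> the vertex \<open>v\<close> is recovered by flipping
  \<open>u\<close> on the set \<open>S\<close>; the inverse is written as an exclusive or of
  \<open>u ! i\<close> and \<open>i \<in> S\<close>.\<close>

lemma bij_betw_diff_set:
  assumes "length u = r"
  shows "bij_betw (diff_set r u) {v. length v = r} (Pow {..<r})"
  by (rule bij_betw_byWitness[where f' = "\<lambda>S. map (\<lambda>i. (u ! i) \<noteq> (i \<in> S)) [0..<r]"])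
    (use assms in \<open>auto simp: diff_set_def intro!: nth_equalityI\<close>)

lemma card_bool_lists: "card {x :: bool list. length x = r} = 2 ^ r"
  using card_lists_length_eq[of "UNIV :: bool set" r] by simp

lemma finite_bool_lists: "finite {x :: bool list. length x = r}"
  using finite_lists_length_eq[of "UNIV :: bool set" r] by simp

text \<open>Under this bijection \<open>v = u\<close> corresponds to the empty set. The value does
  not depend on \<open>u\<close>.\<close>

lemma sum_fact_card_diff_set:
  assumes "length u = r"
  shows "(\<Sum>v | length v = r \<and> v \<noteq> u. fact (card (diff_set r u v))) =
    fact r * (\<Sum>j<r. 1 / fact j :: real)"
proof -
  have "bij_betw (diff_set r u) ({v. length v = r} - {u}) (Pow {..<r} - {{}})"
    using bij_betw_DiffI[OF bij_betw_diff_set[OF assms], of "{u}" "{{}}"] assms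
    by (auto simp: diff_set_def bij_betw_def)
  then have "(\<Sum>v\<in>{v. length v = r} - {u}. fact (card (diff_set r u v)) :: real) =
      (\<Sum>S\<in>Pow {..<r} - {{}}. fact (card S))"
    by (rule sum.reindex_bij_betw)
  moreover have "{v. length v = r} - {u} = {v. length v = r \<and> v \<noteq> u}" by auto
  ultimately show ?thesis by (simp add: sum_fact_card_Pow)
qed

text \<open>Doubling turns the sum over unordered pairs into one over ordered pairs and avoids the
  truncated exponent \<open>r - 1\<close>.\<close>

lemma gpn_hypercube:
  "2 * real (gpn (with_proj (hypercube r))) =
     2 ^ r * fact r * (\<Sum>j<r. 1 / fact j) + 2 * 2 ^ r"
proof -
  interpret pair_graph "hypercube r" by (rule pair_graph_hypercube)
  let ?G = "with_proj (hypercube r)" and ?V = "{x :: bool list. length x = r}"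
  have "2 * (\<Sum>e | e \<subseteq> ?V \<and> card e = 2. real (gpn_unordered ?G e)) =
      (\<Sum>(u, v) | u \<in> ?V \<and> v \<in> ?V \<and> u \<noteq> v. real (gpn_unordered ?G {u, v}))"
    by (rule sum_doubletons[OF finite_bool_lists, symmetric])
  also have "\<dots> = (\<Sum>(u, v) | u \<in> ?V \<and> v \<in> ?V \<and> u \<noteq> v. fact (card (diff_set r u v)))"
    by (rule sum.cong) (auto simp: gpn_unordered_pair[OF sym_arcs] gpn_pair_hypercube)
  also have "{(u, v). u \<in> ?V \<and> v \<in> ?V \<and> u \<noteq> v} = Sigma ?V (\<lambda>u. {v. length v = r \<and> v \<noteq> u})"
    by auto
  also have "(\<Sum>(u, v)\<in>\<dots>. fact (card (diff_set r u v))) =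
      (\<Sum>u\<in>?V. \<Sum>v | length v = r \<and> v \<noteq> u. fact (card (diff_set r u v)))"
    by (rule sum.Sigma[symmetric])
      (auto intro: finite_subset[OF _ finite_bool_lists[of r]])
  also have "\<dots> = (\<Sum>u\<in>?V. fact r * (\<Sum>j<r. 1 / fact j :: real))"
    by (rule sum.cong[OF refl]) (simp add: sum_fact_card_diff_set)
  also have "\<dots> = 2 ^ r * fact r * (\<Sum>j<r. 1 / fact j)"
    by (simp add: card_bool_lists)
  finally show ?thesis by (simp add: gpn_def card_bool_lists)
qed

theorem proposition4:
  shows "(\<forall>r::nat. r \<ge> 1 \<longrightarrow>
            real (gpn (hypercube r)) =
              2 ^ (r - 1) * fact r * (\<Sum>j = 0..r - 1. 1 / fact j) + 2 ^ r)
         \<and> (\<lambda>r. real (gpn (hypercube r))) \<sim>[at_top] (\<lambda>r. 2 ^ (r - 1) * fact r * exp 1 + 2 ^ r)"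
proof
  show exact: "\<forall>r::nat. r \<ge> 1 \<longrightarrow> real (gpn (hypercube r)) =
      2 ^ (r - 1) * fact r * (\<Sum>j = 0..r - 1. 1 / fact j) + 2 ^ r"
  proof (intro allI impI)
    fix r :: nat assume "r \<ge> 1"
    then obtain m where m: "r = Suc m" by (cases r) auto
    have "{..<Suc m} = {0..m}" by auto
    then show "real (gpn (hypercube r)) =
      2 ^ (r - 1) * fact r * (\<Sum>j = 0..r - 1. 1 / fact j) + 2 ^ r"
      using gpn_hypercube[of r] unfolding m power_Suc diff_Suc_1 by simp
  qed
  have "(\<lambda>n. 1 / fact n) sums exp (1 :: real)"
    using exp_converges[of "1 :: real"] by (simp add: field_simps)
  then have lim: "(\<lambda>r. \<Sum>j<r. 1 / fact j) \<longlonglongrightarrow> exp (1 :: real)"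
    by (simp add: sums_def)
  let ?A = "\<lambda>r. 2 ^ (r - 1) * fact r :: real"
  from lim have "(\<lambda>r. (\<Sum>j<r. 1 / fact j) - exp (1 :: real)) \<longlonglongrightarrow> 0"
    by (simp add: LIM_zero_iff)
  then have "(\<lambda>r. (\<Sum>j<r. 1 / fact j) - exp (1 :: real)) \<in> o(\<lambda>_. 1)"
    by (intro smalloI_tendsto) auto
  then have "(\<lambda>r. ?A r * ((\<Sum>j<r. 1 / fact j) - exp 1)) \<in> o(\<lambda>r. ?A r * 1)"
    by (rule landau_o.big_small_mult[OF landau_o.big_refl])
  \<comment> \<open>The scaled error is small relative to \<open>?A\<close>, hence relative to the
    target, which dominates \<open>?A\<close> because \<open>exp 1 \<ge> 1\<close>.\<close>
  also have "(\<lambda>r. ?A r * 1) \<in> O(\<lambda>r. ?A r * exp 1 + 2 ^ r)"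
  proof (intro landau_o.big_mono always_eventually allI)
    fix r
    have "?A r * 1 \<le> ?A r * exp 1 + 2 ^ r"
      by (intro add_increasing2 mult_left_mono) auto
    moreover have "0 \<le> ?A r * 1" by simp
    ultimately show "norm (?A r * 1) \<le> norm (?A r * exp 1 + 2 ^ r)"
      unfolding real_norm_def by linarith
  qed
  \<comment> \<open>Asymptotic equivalence means that the difference is small relative to the
    right-hand side; in this difference the two terms \<open>2 ^ r\<close> cancel.\<close>
  finally have "(\<lambda>r. ?A r * (\<Sum>j<r. 1 / fact j) + 2 ^ r) \<sim>[at_top] (\<lambda>r. ?A r * exp 1 + 2 ^ r)"
    unfolding asymp_equiv_altdef right_diff_distrib add_diff_cancel_right .
  \<comment> \<open>At \<open>r = 0\<close> the range \<open>{0..r - 1}\<close> is a singleton but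
    \<open>{..<r}\<close> is empty, so the ranges are identified only for
    \<open>r \<ge> 1\<close>.\<close>
  moreover have ev: "\<forall>\<^sub>F r in at_top. real (gpn (hypercube r)) =
      2 ^ (r - 1) * fact r * (\<Sum>j<r. 1 / fact j) + 2 ^ r"
    using eventually_ge_at_top[of 1]
  proof eventually_elim
    case (elim r)
    then have "{..<r} = {0..r - 1}" by auto
    then show ?case using exact elim by metis
  qed
  ultimately show "(\<lambda>r. real (gpn (hypercube r))) \<sim>[at_top]
      (\<lambda>r. 2 ^ (r - 1) * fact r * exp 1 + 2 ^ r)"
    by (subst asymp_equiv_cong[OF ev always_eventually[OF allI[OF refl]]])
qed

end
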